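(* Let $C^\bullet(I)$ be the real cellular cochain complex of the interval and let $i_+,p_+,h_+$ be as in the context. The triple $(i_+,p_+,h_+)$ is contraction data $C^\bullet(I)\rightleftarrows\mathbb R\epsilon_+$, i.e. $dh_++h_+d=\mathrm{id}-i_+p_+$. Equivalently, the reduced sector $C^\bullet_{\mathrm{exc}}(I)=\mathrm{span}\{\epsilon_-,\epsilon_{01}\}$ is contractible. For every cochain complex $A^\bullet$ the exceptional tensor factor $A^\bullet\otimes C^\bullet_{\mathrm{exc}}(I)$ is contractible by the tensor-product homotopy.
   Context: $C^\bullet(I)=\mathrm{span}_{\mathbb R}\{\epsilon_0,\epsilon_1,\epsilon_{01}\}$ with $\epsilon_0,\epsilon_1$ in degree $0$, $\epsilon_{01}$ in degree $1$, $d\epsilon_0=-\epsilon_{01}$, $d\epsilon_1=\epsilon_{01}$. Put $\epsilon_+=\tfrac12(\epsilon_0+\epsilon_1)$, $\epsilon_-=\epsilon_1-\epsilon_0$, so $d\epsilon_+=0$, $d\epsilon_-=2\epsilon_{01}$. $p_+:C^\bullet(I)\to\mathbb R\epsilon_+$ is the projection along $\mathrm{span}\{\epsilon_-,\epsilon_{01}\}$ and $i_+$ the inclusion of $\mathbb R\epsilon_+$. The degree $-1$ operator $h_+$ is $h_+(\epsilon_{01})=\tfrac12\epsilon_-$, $h_+(\epsilon_+)=h_+(\epsilon_-)=0$. The tensor-product homotopy on $A^\bullet\otimes C^\bullet_{\mathrm{exc}}(I)$ is $a\otimes x\mapsto(-1)^{|a|}a\otimes h_+(x)$. *)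

theory Defs
  imports "HOL-Analysis.Analysis" "HOL-Analysis.Finite_Function_Topology"
begin

section \<open>Tensor products of real vector spaces\<close>

text \<open>The tensor product is the free real vector space on \<^typ>\<open>'a \<times> 'b\<close> modulo the bilinear
  relations.\<close>

abbreviation generator :: "'a \<Rightarrow> 'b \<Rightarrow> ('a \<times> 'b) \<Rightarrow>\<^sub>0 real" where
  "generator a b \<equiv> Poly_Mapping.single (a, b) 1"

definition tensor_relations :: "(('a::real_vector \<times> 'b::real_vector) \<Rightarrow>\<^sub>0 real) set" where
  "tensor_relations =
     {generator (a + a') b - generator a b - generator a' b | a a' b. True} \<union>
     {generator a (b + b') - generator a b - generator a b' | a b b'. True} \<union>
     {generator (r *\<^sub>R a) b - r *\<^sub>R generator a b | r a b. True} \<union>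
     {generator a (r *\<^sub>R b) - r *\<^sub>R generator a b | r a b. True}"

definition tensor_rel ::
  "(('a::real_vector \<times> 'b::real_vector) \<Rightarrow>\<^sub>0 real) \<Rightarrow> (('a \<times> 'b) \<Rightarrow>\<^sub>0 real) \<Rightarrow> bool" where
  "tensor_rel u v \<longleftrightarrow> u - v \<in> span tensor_relations"

lemma equivp_tensor_rel: "equivp tensor_rel"
proof (intro equivpI reflpI sympI transpI)
  show "tensor_rel u u" for u :: "('a \<times> 'b) \<Rightarrow>\<^sub>0 real"
    by (simp add: tensor_rel_def span_zero)
  show "tensor_rel v u" if "tensor_rel u v" for u v :: "('a \<times> 'b) \<Rightarrow>\<^sub>0 real"
    using span_neg[OF that[unfolded tensor_rel_def]] by (simp add: tensor_rel_def)
  show "tensor_rel u w" if "tensor_rel u v" "tensor_rel v w" for u v w :: "('a \<times> 'b) \<Rightarrow>\<^sub>0 real"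
    using span_add[OF that[unfolded tensor_rel_def]] by (simp add: tensor_rel_def)
qed

quotient_type (overloaded) ('a, 'b) tensor =
  "('a::real_vector \<times> 'b::real_vector) \<Rightarrow>\<^sub>0 real" / tensor_rel
  by (rule equivp_tensor_rel)

instantiation tensor :: (real_vector, real_vector) real_vector
begin

lift_definition zero_tensor :: "('a, 'b) tensor" is 0 .

lift_definition plus_tensor :: "('a, 'b) tensor \<Rightarrow> ('a, 'b) tensor \<Rightarrow> ('a, 'b) tensor" is "(+)"
  unfolding tensor_rel_def by (simp only: add_diff_add span_add)

lift_definition uminus_tensor :: "('a, 'b) tensor \<Rightarrow> ('a, 'b) tensor" is uminus
  unfolding tensor_rel_def by (simp only: minus_diff_minus span_neg)

lift_definition minus_tensor :: "('a, 'b) tensor \<Rightarrow> ('a, 'b) tensor \<Rightarrow> ('a, 'b) tensor" is "(-)"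
  unfolding tensor_rel_def
proof -
  fix u u' v v' :: "('a \<times> 'b) \<Rightarrow>\<^sub>0 real"
  assume "u - u' \<in> span tensor_relations" "v - v' \<in> span tensor_relations"
  then have "(u - u') - (v - v') \<in> span tensor_relations"
    by (rule span_diff)
  then show "u - v - (u' - v') \<in> span tensor_relations"
    by (simp add: algebra_simps)
qed

lift_definition scaleR_tensor :: "real \<Rightarrow> ('a, 'b) tensor \<Rightarrow> ('a, 'b) tensor" is scaleR
  unfolding tensor_rel_def by (simp only: scaleR_right_diff_distrib[symmetric] span_scale)

instance
  by standard
    (transfer; simp add: tensor_rel_def span_zero algebra_simps)+

end

lift_definition pure_tensor :: "'a::real_vector \<Rightarrow> 'b::real_vector \<Rightarrow> ('a, 'b) tensor"
  (infixl "\<otimes>" 72) is generator .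

lemma bilinear_pure_tensor: "bilinear ((\<otimes>) :: 'a::real_vector \<Rightarrow> 'b::real_vector \<Rightarrow> _)"
proof -
  have "(a + a') \<otimes> b = a \<otimes> b + a' \<otimes> b" for a a' :: 'a and b :: 'b
    by transfer (unfold tensor_rel_def tensor_relations_def, subst diff_diff_eq[symmetric], rule span_base, blast)
  moreover have "a \<otimes> (b + b') = a \<otimes> b + a \<otimes> b'" for a :: 'a and b b' :: 'b
    by transfer (unfold tensor_rel_def tensor_relations_def, subst diff_diff_eq[symmetric], rule span_base, blast)
  moreover have "(r *\<^sub>R a) \<otimes> b = r *\<^sub>R (a \<otimes> b)" for r and a :: 'a and b :: 'b
    by transfer (unfold tensor_rel_def tensor_relations_def, rule span_base, blast)
  moreover have "a \<otimes> (r *\<^sub>R b) = r *\<^sub>R (a \<otimes> b)" for r and a :: 'a and b :: 'b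
    by transfer (unfold tensor_rel_def tensor_relations_def, rule span_base, blast)
  ultimately show ?thesis
    by (simp add: bilinear_def linear_iff)
qed

lemma lookup_scaleR_pm: "Poly_Mapping.lookup (r *\<^sub>R u) k = r *\<^sub>R Poly_Mapping.lookup u k"
proof -
  have "finite {i. r *\<^sub>R Poly_Mapping.lookup u i \<noteq> 0}"
    by (rule finite_subset[OF _ finite_lookup[of u]]) auto
  then show ?thesis
    by (simp add: scaleR_poly_mapping_def)
qed

lemma tensor_lift_exists:
  fixes \<beta> :: "'a::real_vector \<Rightarrow> 'b::real_vector \<Rightarrow> 'c::real_vector"
  assumes "bilinear \<beta>"
  shows "\<exists>F. linear F \<and> (\<forall>a b. F (a \<otimes> b) = \<beta> a b)"
proof -
  define G where "G u = (\<Sum>k\<in>Poly_Mapping.keys u. Poly_Mapping.lookup u k *\<^sub>R \<beta> (fst k) (snd k))"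
    for u :: "('a \<times> 'b) \<Rightarrow>\<^sub>0 real"
  have G_sup: "G u = (\<Sum>k\<in>K. Poly_Mapping.lookup u k *\<^sub>R \<beta> (fst k) (snd k))"
    if "finite K" "Poly_Mapping.keys u \<subseteq> K" for u K
    unfolding G_def by (rule sum.mono_neutral_left) (use that in \<open>auto simp: in_keys_iff\<close>)
  have G_add: "G (u + v) = G u + G v" for u v
  proof -
    let ?K = "Poly_Mapping.keys u \<union> Poly_Mapping.keys v"
    have "Poly_Mapping.keys (u + v) \<subseteq> ?K" by (rule Poly_Mapping.keys_add)
    then show ?thesis
      by (subst (1 2 3) G_sup[of ?K]) (auto simp: lookup_add scaleR_add_left sum.distrib)
  qed
  have G_scale: "G (r *\<^sub>R u) = r *\<^sub>R G u" for r u
    by (subst G_sup[of "Poly_Mapping.keys u"])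
      (auto simp: lookup_scaleR_pm in_keys_iff G_def scaleR_sum_right)
  have linG: "linear G"
    by (simp add: linear_iff G_add G_scale)
  have G_gen: "G (generator a b) = \<beta> a b" for a b
    by (simp add: G_def)
  have G_rel: "G u = 0" if "u \<in> span tensor_relations" for u
  proof (rule linear_eq_0_on_span[OF linG _ that])
    fix w :: "('a \<times> 'b) \<Rightarrow>\<^sub>0 real"
    assume "w \<in> tensor_relations"
    then show "G w = 0"
      using assms
      by (auto simp: tensor_relations_def linear_diff[OF linG] G_scale G_gen
          bilinear_ladd bilinear_radd bilinear_lmul bilinear_rmul)
  qed
  have G_cong: "G u = G v" if "tensor_rel u v" for u v
    using G_rel[of "u - v"] that by (simp add: tensor_rel_def linear_diff[OF linG])
  define F where "F t = G (rep_tensor t)" for t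
  have F_abs: "F (abs_tensor u) = G u" for u
    unfolding F_def by (rule G_cong) (metis Quotient_tensor Quotient_rep_abs equivp_tensor_rel equivp_reflp)
  have "linear F"
  proof (rule linearI)
    show "F (s + t) = F s + F t" for s t
      by (induct s, induct t) (simp add: plus_tensor.abs_eq F_abs G_add)
    show "F (r *\<^sub>R t) = r *\<^sub>R F t" for r t
      by (induct t) (simp add: scaleR_tensor.abs_eq F_abs G_scale)
  qed
  moreover have "F (a \<otimes> b) = \<beta> a b" for a b
    by (simp add: pure_tensor.abs_eq F_abs G_gen)
  ultimately show ?thesis by blast
qed

definition linear_on :: "'a::real_vector set \<Rightarrow> ('a \<Rightarrow> 'b::real_vector) \<Rightarrow> bool" where
  "linear_on S f \<longleftrightarrow>
     (\<forall>x\<in>S. \<forall>y\<in>S. f (x + y) = f x + f y) \<and> (\<forall>r. \<forall>x\<in>S. f (r *\<^sub>R x) = r *\<^sub>R f x)"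

text \<open>For subspaces \<open>S\<close> and \<open>T\<close> of the ambient spaces the canonical map from the tensor product
  of \<open>S\<close> and \<open>T\<close> to that of the ambient spaces is injective, so we identify
  the former with its image.\<close>

definition tensor_space :: "'a::real_vector set \<Rightarrow> 'b::real_vector set \<Rightarrow> ('a, 'b) tensor set" where
  "tensor_space S T = span {a \<otimes> b | a b. a \<in> S \<and> b \<in> T}"

text \<open>The map \<open>f \<otimes> g\<close> on \<^term>\<open>tensor_space S T\<close>, for \<open>f\<close> linear on \<open>S\<close> and \<open>g\<close> linear on \<open>T\<close>.
  It exists by \<open>tensor_map_pure\<close> and its values on \<^term>\<open>tensor_space S T\<close> are unique; only these
  are meaningful.\<close>

definition tensor_map ::
  "'a::real_vector set \<Rightarrow> 'b::real_vector set \<Rightarrow> ('a \<Rightarrow> 'c::real_vector) \<Rightarrow> ('b \<Rightarrow> 'd::real_vector)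
    \<Rightarrow> ('a, 'b) tensor \<Rightarrow> ('c, 'd) tensor" where
  "tensor_map S T f g = (SOME F. linear F \<and> (\<forall>a\<in>S. \<forall>b\<in>T. F (a \<otimes> b) = f a \<otimes> g b))"

lemma linear_on_extend:
  fixes f :: "'a::real_vector \<Rightarrow> 'b::real_vector"
  assumes "subspace S" "linear_on S f"
  shows "\<exists>f'. linear f' \<and> (\<forall>x\<in>S. f' x = f x)"
proof -
  obtain B where B: "B \<subseteq> S" "independent B" "S \<subseteq> span B"
    using maximal_independent_subset[of S] by blast
  obtain f' where f': "linear f'" "\<forall>x\<in>B. f' x = f x"
    using linear_independent_extend[OF B(2)] by blast
  have "x \<in> S \<and> f' x = f x" if "x \<in> span B" for x
    using that
  proof (induct rule: span_induct_alt)
    case base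
    have "f 0 = 0"
      using assms(2) subspace_0[OF assms(1)] unfolding linear_on_def by (metis scaleR_zero_left)
    then show ?case
      using subspace_0[OF assms(1)] linear_0[OF f'(1)] by simp
  next
    case (step c x y)
    then show ?case
      using assms B(1) f' unfolding linear_on_def
      by (auto simp: linear_add linear_scale subspace_add subspace_scale subset_iff)
  qed
  then show ?thesis using B(3) f'(1) by blast
qed

lemma tensor_map_pure:
  assumes "subspace S" "linear_on S f" "subspace T" "linear_on T g"
  shows "linear (tensor_map S T f g)"
    and "a \<in> S \<Longrightarrow> b \<in> T \<Longrightarrow> tensor_map S T f g (a \<otimes> b) = f a \<otimes> g b"
proof -
  obtain f' g' where f': "linear f'" "\<forall>x\<in>S. f' x = f x" and g': "linear g'" "\<forall>x\<in>T. g' x = g x"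
    using linear_on_extend assms by metis
  have "bilinear (\<lambda>a b. f' a \<otimes> g' b)"
    using bilinear_pure_tensor f'(1) g'(1) unfolding bilinear_def linear_iff by auto
  from tensor_lift_exists[OF this] obtain F where F: "linear F" "\<forall>a b. F (a \<otimes> b) = f' a \<otimes> g' b"
    by blast
  then have "\<exists>F. linear F \<and> (\<forall>a\<in>S. \<forall>b\<in>T. F (a \<otimes> b) = f a \<otimes> g b)"
    using f'(2) g'(2) by (intro exI[of _ F]) simp
  from someI_ex[OF this] show "linear (tensor_map S T f g)"
    and "a \<in> S \<Longrightarrow> b \<in> T \<Longrightarrow> tensor_map S T f g (a \<otimes> b) = f a \<otimes> g b"
    unfolding tensor_map_def by blast+
qed


section \<open>Real cochain complexes\<close>

text \<open>A \<open>\<int>\<close>-graded real vector space is a family of subspaces of one ambient space; the members of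
  the family need not be independent, so the grading is external. Only the values of
  \<open>differential K n\<close> on \<open>cochains K n\<close> matter.\<close>

record 'a graded_data =
  cochains :: "int \<Rightarrow> 'a set"
  differential :: "int \<Rightarrow> 'a \<Rightarrow> 'a"

definition graded_map ::
  "int \<Rightarrow> 'a::real_vector graded_data \<Rightarrow> 'b::real_vector graded_data \<Rightarrow> (int \<Rightarrow> 'a \<Rightarrow> 'b) \<Rightarrow> bool" where
  "graded_map k K L f \<longleftrightarrow>
     (\<forall>n. linear_on (cochains K n) (f n) \<and> f n ` cochains K n \<subseteq> cochains L (n + k))"

definition cochain_complex :: "'a::real_vector graded_data \<Rightarrow> bool" where
  "cochain_complex K \<longleftrightarrow>
     (\<forall>n. subspace (cochains K n)) \<and>
     graded_map 1 K K (differential K) \<and>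
     (\<forall>n. \<forall>x\<in>cochains K n. differential K (n + 1) (differential K n x) = 0)"

definition cochain_map ::
  "'a::real_vector graded_data \<Rightarrow> 'b::real_vector graded_data \<Rightarrow> (int \<Rightarrow> 'a \<Rightarrow> 'b) \<Rightarrow> bool" where
  "cochain_map K L f \<longleftrightarrow>
     graded_map 0 K L f \<and>
     (\<forall>n. \<forall>x\<in>cochains K n. differential L n (f n x) = f (n + 1) (differential K n x))"

text \<open>Besides the homotopy identity we require \<open>p i = id\<close>, but not the side conditions
  \<open>h\<^sup>2 = 0\<close>, \<open>h i = 0\<close>, \<open>p h = 0\<close>.\<close>

definition contraction_data ::
  "'a::real_vector graded_data \<Rightarrow> 'b::real_vector graded_data
    \<Rightarrow> (int \<Rightarrow> 'b \<Rightarrow> 'a) \<Rightarrow> (int \<Rightarrow> 'a \<Rightarrow> 'b) \<Rightarrow> (int \<Rightarrow> 'a \<Rightarrow> 'a) \<Rightarrow> bool" where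
  "contraction_data K L i p h \<longleftrightarrow>
     cochain_complex K \<and> cochain_complex L \<and>
     cochain_map L K i \<and> cochain_map K L p \<and> graded_map (- 1) K K h \<and>
     (\<forall>n. \<forall>y\<in>cochains L n. p n (i n y) = y) \<and>
     (\<forall>n. \<forall>x\<in>cochains K n.
        differential K (n - 1) (h n x) + h (n + 1) (differential K n x) = x - i n (p n x))"

definition contracting_homotopy ::
  "'a::real_vector graded_data \<Rightarrow> (int \<Rightarrow> 'a \<Rightarrow> 'a) \<Rightarrow> bool" where
  "contracting_homotopy K h \<longleftrightarrow>
     cochain_complex K \<and> graded_map (- 1) K K h \<and>
     (\<forall>n. \<forall>x\<in>cochains K n.
        differential K (n - 1) (h n x) + h (n + 1) (differential K n x) = x)"

text \<open>Not to be confused with the topological \<^const>\<open>contractible\<close>.\<close>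

definition contractible_complex :: "'a::real_vector graded_data \<Rightarrow> bool" where
  "contractible_complex K \<longleftrightarrow> (\<exists>h. contracting_homotopy K h)"


section \<open>Tensor products of complexes\<close>

text \<open>The degree \<open>n\<close> part is the external direct sum over \<open>p\<close> of the tensor products of \<open>K\<^sup>p\<close> and
  \<open>L\<^sup>n\<^sup>-\<^sup>p\<close>: an element is a finitely supported family whose entry at \<open>p\<close> lies in the \<open>p\<close>-th
  summand. The differential is given on the \<open>p\<close>-th summand by
  \<open>a \<otimes> b \<mapsto> da \<otimes> b + (-1)\<^sup>p a \<otimes> db\<close>, whose two terms lie in the summands \<open>p + 1\<close> and \<open>p\<close>
  of degree \<open>n + 1\<close>.\<close>

definition tensor_complex ::
  "'a::real_vector graded_data \<Rightarrow> 'b::real_vector graded_data \<Rightarrow> (int \<Rightarrow>\<^sub>0 ('a, 'b) tensor) graded_data"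
where
  "tensor_complex K L =
    \<lparr>cochains = (\<lambda>n. {x. \<forall>p. Poly_Mapping.lookup x p \<in> tensor_space (cochains K p) (cochains L (n - p))}),
     differential = (\<lambda>n x. \<Sum>p\<in>Poly_Mapping.keys x.
       Poly_Mapping.single (p + 1)
         (tensor_map (cochains K p) (cochains L (n - p)) (differential K p) id
           (Poly_Mapping.lookup x p)) +
       Poly_Mapping.single p
         ((- 1) powi p *\<^sub>R
           tensor_map (cochains K p) (cochains L (n - p)) id (differential L (n - p))
             (Poly_Mapping.lookup x p)))\<rparr>"

text \<open>\<open>a \<otimes> b \<mapsto> (-1)\<^sup>p a \<otimes> h b\<close> for \<open>a\<close> of degree \<open>p\<close>.\<close>

definition tensor_homotopy ::
  "'a::real_vector graded_data \<Rightarrow> 'b::real_vector graded_data \<Rightarrow> (int \<Rightarrow> 'b \<Rightarrow> 'b)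
    \<Rightarrow> int \<Rightarrow> (int \<Rightarrow>\<^sub>0 ('a, 'b) tensor) \<Rightarrow> (int \<Rightarrow>\<^sub>0 ('a, 'b) tensor)" where
  "tensor_homotopy K L h n x = (\<Sum>p\<in>Poly_Mapping.keys x.
     Poly_Mapping.single p
       ((- 1) powi p *\<^sub>R
         tensor_map (cochains K p) (cochains L (n - p)) id (h (n - p)) (Poly_Mapping.lookup x p)))"


section \<open>The cellular cochain complex of the interval\<close>

datatype cell = Vertex0 | Vertex1 | Edge

lemma UNIV_cell: "(UNIV :: cell set) = {Vertex0, Vertex1, Edge}"
  using cell.exhaust by auto

instance cell :: finite
  by standard (simp add: UNIV_cell)

definition eps0 :: "real ^ cell" where "eps0 = axis Vertex0 1"
definition eps1 :: "real ^ cell" where "eps1 = axis Vertex1 1"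
definition eps01 :: "real ^ cell" where "eps01 = axis Edge 1"

definition eps_plus :: "real ^ cell" where "eps_plus = (1 / 2) *\<^sub>R (eps0 + eps1)"
definition eps_minus :: "real ^ cell" where "eps_minus = eps1 - eps0"

definition d_interval :: "real ^ cell \<Rightarrow> real ^ cell" where
  "d_interval = construct {eps0, eps1, eps01}
     (\<lambda>e. if e = eps0 then - eps01 else if e = eps1 then eps01 else 0)"

definition interval_complex :: "(real ^ cell) graded_data" where
  "interval_complex =
    \<lparr>cochains = (\<lambda>n. if n = 0 then span {eps0, eps1} else if n = 1 then span {eps01} else {0}),
     differential = (\<lambda>n. d_interval)\<rparr>"

definition plus_complex :: "(real ^ cell) graded_data" where
  "plus_complex =
    \<lparr>cochains = (\<lambda>n. if n = 0 then span {eps_plus} else {0}),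
     differential = (\<lambda>n. d_interval)\<rparr>"

definition exc_complex :: "(real ^ cell) graded_data" where
  "exc_complex =
    \<lparr>cochains = (\<lambda>n. if n = 0 then span {eps_minus} else if n = 1 then span {eps01} else {0}),
     differential = (\<lambda>n. d_interval)\<rparr>"

definition projection_along :: "'a::real_vector set \<Rightarrow> 'a set \<Rightarrow> 'a \<Rightarrow> 'a" where
  "projection_along U W x = (THE y. y \<in> U \<and> x - y \<in> W)"

definition i_plus :: "int \<Rightarrow> real ^ cell \<Rightarrow> real ^ cell" where
  "i_plus n x = x"

definition p_plus :: "int \<Rightarrow> real ^ cell \<Rightarrow> real ^ cell" where
  "p_plus n = projection_along (span {eps_plus}) (span {eps_minus, eps01})"

definition h_plus :: "int \<Rightarrow> real ^ cell \<Rightarrow> real ^ cell" where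
  "h_plus n = construct {eps_plus, eps_minus, eps01}
     (\<lambda>e. if e = eps01 then (1 / 2) *\<^sub>R eps_minus else 0)"

lemma eps_nth:
  "eps0 $ c = (if c = Vertex0 then 1 else 0)"
  "eps1 $ c = (if c = Vertex1 then 1 else 0)"
  "eps01 $ c = (if c = Edge then 1 else 0)"
  "eps_plus $ c = (if c = Edge then 0 else 1 / 2)"
  "eps_minus $ c = (case c of Vertex0 \<Rightarrow> - 1 | Vertex1 \<Rightarrow> 1 | Edge \<Rightarrow> 0)"
  by (cases c; simp add: eps0_def eps1_def eps01_def eps_plus_def eps_minus_def axis_def)+

lemma vec_cell_eq_iff:
  "(x :: real ^ cell) = y \<longleftrightarrow> x $ Vertex0 = y $ Vertex0 \<and> x $ Vertex1 = y $ Vertex1 \<and> x $ Edge = y $ Edge"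
  unfolding vec_eq_iff by (metis cell.exhaust)

lemma independent_eps: "independent {eps0, eps1, eps01}"
proof -
  have "eps0 \<noteq> eps1" "eps0 \<noteq> eps01" "eps1 \<noteq> eps01"
    by (simp_all add: vec_cell_eq_iff eps_nth)
  moreover have "eps0 \<notin> span {eps1, eps01}" "eps1 \<notin> span {eps01}" "eps01 \<noteq> 0"
    by (auto simp: span_insert span_singleton vec_cell_eq_iff eps_nth)
  ultimately show ?thesis
    by (simp add: independent_insert)
qed

lemma independent_eps_pm: "independent {eps_plus, eps_minus, eps01}"
proof -
  have "eps_plus \<noteq> eps_minus" "eps_plus \<noteq> eps01" "eps_minus \<noteq> eps01"
    by (simp_all add: vec_cell_eq_iff eps_nth)
  moreover have "eps_plus \<notin> span {eps_minus, eps01}" "eps_minus \<notin> span {eps01}" "eps01 \<noteq> 0"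
    by (auto simp: span_insert span_singleton vec_cell_eq_iff eps_nth)
  ultimately show ?thesis
    by (simp add: independent_insert)
qed

lemma linear_d_interval: "linear d_interval"
  unfolding d_interval_def by (rule linear_construct[OF independent_eps])

lemma d_interval_basis:
  "d_interval eps0 = - eps01" "d_interval eps1 = eps01" "d_interval eps01 = 0"
  unfolding d_interval_def
  by (subst construct_basis[OF independent_eps]; simp add: vec_cell_eq_iff eps_nth)+

lemma d_interval_eps_pm:
  "d_interval eps_plus = 0" "d_interval eps_minus = 2 *\<^sub>R eps01"
  by (simp_all add: eps_plus_def eps_minus_def d_interval_basis linear_add[OF linear_d_interval]
      linear_diff[OF linear_d_interval] linear_scale[OF linear_d_interval] scaleR_2)

lemma linear_h_plus: "linear (h_plus n)"
  unfolding h_plus_def by (rule linear_construct[OF independent_eps_pm])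

lemma h_plus_basis:
  "h_plus n eps01 = (1 / 2) *\<^sub>R eps_minus" "h_plus n eps_plus = 0" "h_plus n eps_minus = 0"
  unfolding h_plus_def
  by (subst construct_basis[OF independent_eps_pm]; simp add: vec_cell_eq_iff eps_nth)+

end

theory Submission
  imports Defs
begin

text \<open>The interval part is a computation in coordinates. For the tensor part, every map involved is
  linear on the whole ambient space, and the degree \<open>n\<close> part of the tensor complex is spanned by the
  homogeneous pure tensors; hence it is enough to compare values on \<open>a \<otimes> b\<close> with \<open>a\<close> of degree \<open>p\<close>.
  There the terms \<open>da \<otimes> hb\<close> occur in \<open>dh\<close> and \<open>hd\<close> with signs \<open>(-1)\<^sup>p\<close> and \<open>(-1)\<^sup>p\<^sup>+\<^sup>1\<close> and cancel,
  leaving \<open>a \<otimes> (dh + hd) b = a \<otimes> b\<close>. The argument works for any contractible second factor.\<close>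

section \<open>Tensor products with a contractible complex\<close>

lemma linear_single: "linear (Poly_Mapping.single k :: 'a::real_vector \<Rightarrow> _)"
proof (rule linearI)
  show "Poly_Mapping.single k (r *\<^sub>R x) = r *\<^sub>R Poly_Mapping.single k x" for r and x :: 'a
    by (rule poly_mapping_eqI) (simp add: lookup_scaleR_pm lookup_single when_def)
qed (rule single_add)

text \<open>The index set \<open>keys x\<close> varies with \<open>x\<close>, so additivity is not
  termwise. As \<open>F k 0 = 0\<close>, each sum may run over any finite set containing the
  support, and \<open>x\<close>, \<open>y\<close>, \<open>x + y\<close> share one. Differential and
  homotopy of the tensor complex both have this shape.\<close>

lemma linear_sum_keys:
  fixes F :: "'k \<Rightarrow> 'a::real_vector \<Rightarrow> 'b::real_vector"
  assumes "\<And>k. linear (F k)"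
  shows "linear (\<lambda>x. \<Sum>k\<in>Poly_Mapping.keys x. F k (Poly_Mapping.lookup x k))"
proof -
  have sup: "(\<Sum>k\<in>Poly_Mapping.keys x. F k (Poly_Mapping.lookup x k))
      = (\<Sum>k\<in>K. F k (Poly_Mapping.lookup x k))"
    if "finite K" "Poly_Mapping.keys x \<subseteq> K" for x K
    by (rule sum.mono_neutral_left) (use that in \<open>auto simp: in_keys_iff linear_0[OF assms]\<close>)
  show ?thesis
  proof (rule linearI)
    fix x y :: "'k \<Rightarrow>\<^sub>0 'a" and r :: real
    let ?K = "Poly_Mapping.keys x \<union> Poly_Mapping.keys y"
    have "Poly_Mapping.keys (x + y) \<subseteq> ?K"
      by (rule Poly_Mapping.keys_add)
    then show "(\<Sum>k\<in>Poly_Mapping.keys (x + y). F k (Poly_Mapping.lookup (x + y) k)) =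
        (\<Sum>k\<in>Poly_Mapping.keys x. F k (Poly_Mapping.lookup x k)) +
        (\<Sum>k\<in>Poly_Mapping.keys y. F k (Poly_Mapping.lookup y k))"
      by (subst (1 2 3) sup[of ?K]) (auto simp: lookup_add linear_add[OF assms] sum.distrib)
    show "(\<Sum>k\<in>Poly_Mapping.keys (r *\<^sub>R x). F k (Poly_Mapping.lookup (r *\<^sub>R x) k)) =
        r *\<^sub>R (\<Sum>k\<in>Poly_Mapping.keys x. F k (Poly_Mapping.lookup x k))"
      by (subst sup[of "Poly_Mapping.keys x"])
        (auto simp: lookup_scaleR_pm in_keys_iff linear_scale[OF assms] scaleR_sum_right)
  qed
qed

lemma sum_keys_single:
  assumes "linear (F k)"
  shows "(\<Sum>j\<in>Poly_Mapping.keys (Poly_Mapping.single k t).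
      F j (Poly_Mapping.lookup (Poly_Mapping.single k t) j)) = F k t"
  \<comment> \<open>For \<open>t = 0\<close> the support is empty rather than \<open>{k}\<close>;
    the empty sum agrees with \<open>F k 0 = 0\<close>.\<close>
  using linear_0[OF assms] by (cases "t = 0") auto

lemma poly_mapping_eq_sum_single:
  "x = (\<Sum>k\<in>Poly_Mapping.keys x. Poly_Mapping.single k (Poly_Mapping.lookup x k))"
  by (rule poly_mapping_eqI)
    (auto simp: lookup_sum lookup_single when_def sum.delta' in_keys_iff)

lemma linear_on_linear: "linear f \<Longrightarrow> linear_on S f"
  by (simp add: linear_on_def linear_add linear_scale)

lemma linear_on_id: "linear_on S id"
  by (simp add: linear_on_def)

section \<open>Reduction to homogeneous pure tensors\<close>

text \<open>The index \<open>p\<close> is kept through \<open>single p\<close> because the grading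
  is external: the same \<open>a\<close> may lie in several \<open>cochains K p\<close>.\<close>

definition pure_cochains ::
  "'a::real_vector graded_data \<Rightarrow> 'b::real_vector graded_data \<Rightarrow> int \<Rightarrow> (int \<Rightarrow>\<^sub>0 ('a, 'b) tensor) set"
where
  "pure_cochains K L n =
    {Poly_Mapping.single p (a \<otimes> b) | p a b. a \<in> cochains K p \<and> b \<in> cochains L (n - p)}"

text \<open>The cochains form a subspace containing the generators. Conversely, a cochain is the
  finite sum of its entries placed in their summands, and the linear map \<open>single p\<close>
  carries the span of pure tensors into the span of generators.\<close>

lemma cochains_tensor_complex: "cochains (tensor_complex K L) n = span (pure_cochains K L n)"
proof
  let ?T = "\<lambda>p. tensor_space (cochains K p) (cochains L (n - p))"
  have T: "subspace (?T p)" for p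
    by (simp add: tensor_space_def)
  have pure: "a \<otimes> b \<in> ?T p" if "a \<in> cochains K p" "b \<in> cochains L (n - p)" for a b p
    unfolding tensor_space_def by (rule span_base) (use that in blast)
  have "subspace (cochains (tensor_complex K L) n)"
    using T by (auto simp: tensor_complex_def subspace_def lookup_add lookup_scaleR_pm)
  moreover have "pure_cochains K L n \<subseteq> cochains (tensor_complex K L) n"
    using subspace_0[OF T] pure
    by (auto simp: tensor_complex_def pure_cochains_def lookup_single when_def)
  ultimately show "span (pure_cochains K L n) \<subseteq> cochains (tensor_complex K L) n"
    by (rule span_minimal[rotated])
  show "cochains (tensor_complex K L) n \<subseteq> span (pure_cochains K L n)"
  proof
    fix x assume "x \<in> cochains (tensor_complex K L) n"
    then have x: "Poly_Mapping.lookup x p \<in> ?T p" for p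
      by (simp add: tensor_complex_def)
    have "Poly_Mapping.single p t \<in> span (pure_cochains K L n)" if "t \<in> ?T p" for p t
    proof -
      have "Poly_Mapping.single p t \<in>
          span (Poly_Mapping.single p ` {a \<otimes> b | a b. a \<in> cochains K p \<and> b \<in> cochains L (n - p)})"
        using that unfolding tensor_space_def linear_span_image[OF linear_single] by blast
      then show ?thesis
        by (rule set_mp[OF span_mono, rotated]) (auto simp: pure_cochains_def)
    qed
    then have "(\<Sum>p\<in>Poly_Mapping.keys x. Poly_Mapping.single p (Poly_Mapping.lookup x p))
        \<in> span (pure_cochains K L n)"
      using x by (intro span_sum) blast
    then show "x \<in> span (pure_cochains K L n)"
      by (simp flip: poly_mapping_eq_sum_single)
  qed
qed

text \<open>The second degree is a free \<open>q\<close> with \<open>p + q = n\<close>, so that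
  shifted degrees such as \<open>n - p + 1\<close> match without rewriting.\<close>

lemma single_tensor_in_cochains:
  "a \<in> cochains K p \<Longrightarrow> b \<in> cochains L q \<Longrightarrow> p + q = n \<Longrightarrow>
    Poly_Mapping.single p (a \<otimes> b) \<in> cochains (tensor_complex K L) n"
  unfolding cochains_tensor_complex pure_cochains_def
  by (intro span_base CollectI exI[of _ p] exI[of _ a] exI[of _ b]) auto

lemma subspace_cochains_tensor_complex: "subspace (cochains (tensor_complex K L) n)"
  by (simp add: cochains_tensor_complex)

lemma graded_map_tensor_complexI:
  assumes "\<And>n. linear (f n)"
    and "\<And>n p a b. a \<in> cochains K p \<Longrightarrow> b \<in> cochains L (n - p) \<Longrightarrow>
      f n (Poly_Mapping.single p (a \<otimes> b)) \<in> cochains M (n + k)"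
    and "\<And>n. subspace (cochains M n)"
  shows "graded_map k (tensor_complex K L) M f"
proof -
  have "f n ` cochains (tensor_complex K L) n \<subseteq> cochains M (n + k)" for n
    unfolding cochains_tensor_complex linear_span_image[OF assms(1), symmetric]
    by (rule span_minimal) (use assms(2,3) in \<open>auto simp: pure_cochains_def\<close>)
  then show ?thesis
    by (simp add: graded_map_def linear_on_linear assms(1))
qed

lemma linear_eq_on_tensor_complex:
  assumes "linear f" "linear g" "x \<in> cochains (tensor_complex K L) n"
    and "\<And>p a b. a \<in> cochains K p \<Longrightarrow> b \<in> cochains L (n - p) \<Longrightarrow>
      f (Poly_Mapping.single p (a \<otimes> b)) = g (Poly_Mapping.single p (a \<otimes> b))"
  shows "f x = g x"
  by (rule linear_eq_on_span[OF assms(1,2) _ assms(3)[unfolded cochains_tensor_complex]])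
    (use assms(4) in \<open>auto simp: pure_cochains_def\<close>)

section \<open>Differential and homotopy on pure tensors\<close>

lemma cochain_complexD:
  assumes "cochain_complex K"
  shows "subspace (cochains K n)" "linear_on (cochains K n) (differential K n)"
    and "x \<in> cochains K n \<Longrightarrow> differential K n x \<in> cochains K (n + 1)"
    and "x \<in> cochains K n \<Longrightarrow> differential K (n + 1) (differential K n x) = 0"
  using assms unfolding cochain_complex_def graded_map_def by blast+

lemma
  assumes K: "cochain_complex K" and L: "cochain_complex L"
  shows linear_tensor_differential: "linear (differential (tensor_complex K L) n)"
    and tensor_differential_single:
      "a \<in> cochains K p \<Longrightarrow> b \<in> cochains L q \<Longrightarrow> p + q = n \<Longrightarrow>
        differential (tensor_complex K L) n (Poly_Mapping.single p (a \<otimes> b)) =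
          Poly_Mapping.single (p + 1) (differential K p a \<otimes> b) +
          (- 1) powi p *\<^sub>R Poly_Mapping.single p (a \<otimes> differential L q b)"
proof -
  \<comment> \<open>The contribution of the \<open>p\<close>-th entry. It is linear in an arbitrary
    tensor \<open>t\<close>, because \<open>tensor_map\<close> selects a map that is linear on the
    ambient space.\<close>
  define F where "F p t =
      Poly_Mapping.single (p + 1)
        (tensor_map (cochains K p) (cochains L (n - p)) (differential K p) id t) +
      Poly_Mapping.single p
        ((- 1) powi p *\<^sub>R
          tensor_map (cochains K p) (cochains L (n - p)) id (differential L (n - p)) t)" for p t
  note [simp] = tensor_map_pure cochain_complexD(1,2)[OF K] cochain_complexD(1,2)[OF L] linear_on_id
  have F: "linear (F p)" for p
    unfolding F_def
    by (intro linear_compose_add linear_compose[OF _ linear_single, unfolded o_def]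
        linear_compose_scale_right) auto
  have d: "differential (tensor_complex K L) n =
      (\<lambda>x. \<Sum>p\<in>Poly_Mapping.keys x. F p (Poly_Mapping.lookup x p))"
    by (simp add: tensor_complex_def F_def)
  show "linear (differential (tensor_complex K L) n)"
    unfolding d by (rule linear_sum_keys[OF F])
  show "differential (tensor_complex K L) n (Poly_Mapping.single p (a \<otimes> b)) =
          Poly_Mapping.single (p + 1) (differential K p a \<otimes> b) +
          (- 1) powi p *\<^sub>R Poly_Mapping.single p (a \<otimes> differential L q b)"
    if "a \<in> cochains K p" "b \<in> cochains L q" "p + q = n"
  proof -
    have q: "q = n - p"
      using that by simp
    show ?thesis
      unfolding d sum_keys_single[of F, OF F]
      using that by (simp add: F_def q linear_scale[OF linear_single])
  qed
qed

lemma
  assumes K: "cochain_complex K" and L: "cochain_complex L" and h: "graded_map k L L h"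
  shows linear_tensor_homotopy: "linear (tensor_homotopy K L h n)"
    and tensor_homotopy_single:
      "a \<in> cochains K p \<Longrightarrow> b \<in> cochains L q \<Longrightarrow> p + q = n \<Longrightarrow>
        tensor_homotopy K L h n (Poly_Mapping.single p (a \<otimes> b)) =
          (- 1) powi p *\<^sub>R Poly_Mapping.single p (a \<otimes> h q b)"
proof -
  define F where "F p t = Poly_Mapping.single p
      ((- 1) powi p *\<^sub>R tensor_map (cochains K p) (cochains L (n - p)) id (h (n - p)) t)" for p t
  have h': "linear_on (cochains L m) (h m)" for m
    using h by (simp add: graded_map_def)
  note [simp] = tensor_map_pure cochain_complexD(1,2)[OF K] cochain_complexD(1,2)[OF L] linear_on_id h'
  have F: "linear (F p)" for p
    unfolding F_def
    by (intro linear_compose[OF _ linear_single, unfolded o_def] linear_compose_scale_right) auto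
  have H: "tensor_homotopy K L h n =
      (\<lambda>x. \<Sum>p\<in>Poly_Mapping.keys x. F p (Poly_Mapping.lookup x p))"
    by (simp add: tensor_homotopy_def F_def fun_eq_iff)
  show "linear (tensor_homotopy K L h n)"
    unfolding H by (rule linear_sum_keys[OF F])
  show "tensor_homotopy K L h n (Poly_Mapping.single p (a \<otimes> b)) =
          (- 1) powi p *\<^sub>R Poly_Mapping.single p (a \<otimes> h q b)"
    if "a \<in> cochains K p" "b \<in> cochains L q" "p + q = n"
  proof -
    have q: "q = n - p"
      using that by simp
    show ?thesis
      unfolding H sum_keys_single[of F, OF F]
      using that by (simp add: F_def q linear_scale[OF linear_single])
  qed
qed

lemma powi_minus_one_Suc: "(- 1 :: real) powi (p + 1) = - ((- 1) powi p)"
  by (simp add: power_int_add)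

lemma powi_minus_one_square: "(- 1 :: real) powi p * (- 1) powi p = 1"
  by (simp flip: power_int_mult_distrib)

lemmas pure_tensor_simps [simp] =
  bilinear_lzero[OF bilinear_pure_tensor] bilinear_rzero[OF bilinear_pure_tensor]

section \<open>The tensor complex and its contraction\<close>

text \<open>On \<open>a \<otimes> b\<close> the terms with \<open>dda\<close> and \<open>ddb\<close>
  vanish. The two copies of \<open>da \<otimes> db\<close> lie in summand \<open>p + 1\<close> with
  signs \<open>(-1)^(p+1)\<close> and \<open>(-1)^p\<close>, and cancel.\<close>

lemma cochain_complex_tensor_complex:
  assumes K: "cochain_complex K" and L: "cochain_complex L"
  shows "cochain_complex (tensor_complex K L)"
proof -
  note lin = linear_tensor_differential[OF K L]
  note sg = tensor_differential_single[OF K L]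
  note mem = cochain_complexD(3)[OF K] cochain_complexD(3)[OF L]
  have "graded_map 1 (tensor_complex K L) (tensor_complex K L) (differential (tensor_complex K L))"
  proof (rule graded_map_tensor_complexI[OF lin _ subspace_cochains_tensor_complex])
    fix n p a b
    assume ab: "a \<in> cochains K p" "b \<in> cochains L (n - p)"
    show "differential (tensor_complex K L) n (Poly_Mapping.single p (a \<otimes> b))
        \<in> cochains (tensor_complex K L) (n + 1)"
      unfolding sg[OF ab, of n, simplified]
      by (intro subspace_add subspace_scale subspace_cochains_tensor_complex
          single_tensor_in_cochains[OF mem(1)[OF ab(1)] ab(2)]
          single_tensor_in_cochains[OF ab(1) mem(2)[OF ab(2)]]) simp_all
  qed
  moreover have "differential (tensor_complex K L) (n + 1) (differential (tensor_complex K L) n x) = 0"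
    if "x \<in> cochains (tensor_complex K L) n" for n x
  proof (rule linear_eq_on_tensor_complex[OF _ linear_zero that])
    show "linear (\<lambda>x. differential (tensor_complex K L) (n + 1) (differential (tensor_complex K L) n x))"
      using linear_compose[OF lin lin] by (simp add: o_def)
    fix p a b
    assume ab: "a \<in> cochains K p" "b \<in> cochains L (n - p)"
    show "differential (tensor_complex K L) (n + 1)
        (differential (tensor_complex K L) n (Poly_Mapping.single p (a \<otimes> b))) = 0"
      using cochain_complexD(4)[OF K ab(1)] cochain_complexD(4)[OF L ab(2)]
      by (simp add: sg[OF ab] sg[OF mem(1)[OF ab(1)] ab(2)] sg[OF ab(1) mem(2)[OF ab(2)]]
          linear_add[OF lin] linear_scale[OF lin] powi_minus_one_Suc linear_0[OF linear_single])
  qed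
  ultimately show ?thesis
    by (simp add: cochain_complex_def subspace_cochains_tensor_complex)
qed

theorem contracting_homotopy_tensor_complex:
  assumes K: "cochain_complex K" and cL: "contracting_homotopy L h"
  shows "contracting_homotopy (tensor_complex K L) (tensor_homotopy K L h)"
proof -
  from cL have L: "cochain_complex L" and h: "graded_map (- 1) L L h"
    and dh: "\<And>n x. x \<in> cochains L n \<Longrightarrow>
      differential L (n - 1) (h n x) + h (n + 1) (differential L n x) = x"
    by (auto simp: contracting_homotopy_def)
  note lin = linear_tensor_differential[OF K L] and linh = linear_tensor_homotopy[OF K L h]
  note sg = tensor_differential_single[OF K L] and sh = tensor_homotopy_single[OF K L h]
  note mem = cochain_complexD(3)[OF K] cochain_complexD(3)[OF L]
  have memh: "h n x \<in> cochains L (n - 1)" if "x \<in> cochains L n" for n x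
    using h that unfolding graded_map_def by force
  have "graded_map (- 1) (tensor_complex K L) (tensor_complex K L) (tensor_homotopy K L h)"
  proof (rule graded_map_tensor_complexI[OF linh _ subspace_cochains_tensor_complex])
    fix n p a b
    assume ab: "a \<in> cochains K p" "b \<in> cochains L (n - p)"
    show "tensor_homotopy K L h n (Poly_Mapping.single p (a \<otimes> b))
        \<in> cochains (tensor_complex K L) (n + - 1)"
      unfolding sh[OF ab, of n, simplified]
      using ab memh by (intro subspace_scale subspace_cochains_tensor_complex
          single_tensor_in_cochains[where q = "n - p - 1"]) auto
  qed
  moreover have "differential (tensor_complex K L) (n - 1) (tensor_homotopy K L h n x) +
      tensor_homotopy K L h (n + 1) (differential (tensor_complex K L) n x) = x"
    if "x \<in> cochains (tensor_complex K L) n" for n x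
  proof (rule linear_eq_on_tensor_complex[OF _ linear_ident that])
    show "linear (\<lambda>x. differential (tensor_complex K L) (n - 1) (tensor_homotopy K L h n x) +
        tensor_homotopy K L h (n + 1) (differential (tensor_complex K L) n x))"
      using linear_compose_add[OF linear_compose[OF linh lin] linear_compose[OF lin linh]]
      by (simp add: o_def)
    fix p a b
    assume ab: "a \<in> cochains K p" "b \<in> cochains L (n - p)"
    let ?S = "Poly_Mapping.single :: int \<Rightarrow> ('a, 'b) tensor \<Rightarrow> _"
    have "differential (tensor_complex K L) (n - 1) (tensor_homotopy K L h n (?S p (a \<otimes> b))) +
        tensor_homotopy K L h (n + 1) (differential (tensor_complex K L) n (?S p (a \<otimes> b))) =
        ?S p (a \<otimes> differential L (n - p - 1) (h (n - p) b)) +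
        ?S p (a \<otimes> h (n - p + 1) (differential L (n - p) b))"
      \<comment> \<open>The surviving terms carry \<open>(-1)^p\<close> twice, once from the
        homotopy and once from the differential of the second factor, hence sign 1.\<close>
      by (simp add: sg[OF ab] sh[OF ab] sg[OF ab(1) memh[OF ab(2)]] sh[OF mem(1)[OF ab(1)] ab(2)]
          sh[OF ab(1) mem(2)[OF ab(2)]] linear_add[OF lin] linear_scale[OF lin] linear_add[OF linh]
          linear_scale[OF linh] powi_minus_one_Suc scaleR_add_right powi_minus_one_square)
    also have "\<dots> = ?S p (a \<otimes> b)"
      by (simp add: dh[OF ab(2)] flip: single_add bilinear_radd[OF bilinear_pure_tensor])
    finally show "differential (tensor_complex K L) (n - 1) (tensor_homotopy K L h n (?S p (a \<otimes> b))) +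
        tensor_homotopy K L h (n + 1) (differential (tensor_complex K L) n (?S p (a \<otimes> b))) =
        ?S p (a \<otimes> b)" .
  qed
  ultimately show ?thesis
    by (simp add: contracting_homotopy_def cochain_complex_tensor_complex[OF K L])
qed


section \<open>The interval in coordinates\<close>

text \<open>Coordinates in the two bases on which \<open>d_interval\<close> and
  \<open>h_plus\<close> are respectively defined.\<close>

lemma cell_expand:
  "x = (x $ Vertex0) *\<^sub>R eps0 + (x $ Vertex1) *\<^sub>R eps1 + (x $ Edge) *\<^sub>R eps01"
  "x = (x $ Vertex0 + x $ Vertex1) *\<^sub>R eps_plus + ((x $ Vertex1 - x $ Vertex0) / 2) *\<^sub>R eps_minus
    + (x $ Edge) *\<^sub>R eps01"
  by (simp_all add: vec_cell_eq_iff eps_nth field_simps)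

lemma d_interval_eq: "d_interval x = (x $ Vertex1 - x $ Vertex0) *\<^sub>R eps01"
  by (subst cell_expand(1)[of x], simp only: linear_add[OF linear_d_interval]
      linear_scale[OF linear_d_interval] d_interval_basis) (simp add: algebra_simps)

lemma h_plus_eq: "h_plus n x = (x $ Edge / 2) *\<^sub>R eps_minus"
  by (subst cell_expand(2)[of x], simp only: linear_add[OF linear_h_plus]
      linear_scale[OF linear_h_plus] h_plus_basis) simp

lemma span_eps:
  "x \<in> span {eps0, eps1} \<longleftrightarrow> x $ Edge = 0"
  "x \<in> span {eps01} \<longleftrightarrow> x $ Vertex0 = 0 \<and> x $ Vertex1 = 0"
  "x \<in> span {eps_plus} \<longleftrightarrow> x $ Vertex0 = x $ Vertex1 \<and> x $ Edge = 0"
  "x \<in> span {eps_minus} \<longleftrightarrow> x $ Vertex0 = - x $ Vertex1 \<and> x $ Edge = 0"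
  "x \<in> span {eps_minus, eps01} \<longleftrightarrow> x $ Vertex0 = - x $ Vertex1"
  by (auto simp: span_insert span_singleton vec_cell_eq_iff eps_nth algebra_simps
      \<comment> \<open>Coefficients of \<open>eps0\<close>, of \<open>eps1\<close> or
        \<open>eps_minus\<close>, and of \<open>eps_plus\<close>; the factor 2 undoes its vertex
        values 1/2.\<close>
      intro: exI[of _ "x $ Vertex0"] exI[of _ "x $ Vertex1"] exI[of _ "2 * x $ Vertex1"])

lemma p_plus_eq: "p_plus n x = (x $ Vertex0 + x $ Vertex1) *\<^sub>R eps_plus"
  unfolding p_plus_def projection_along_def span_eps
  \<comment> \<open>Uniqueness: \<open>y\<close> has equal vertex values and those of
    \<open>x - y\<close> are opposite, so both values of \<open>y\<close> are the mean of the vertex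
    values of \<open>x\<close>.\<close>
  by (rule the_equality) (auto simp: vec_cell_eq_iff eps_nth field_simps)

text \<open>In the second expansion of \<open>cell_expand\<close>, \<open>i p x\<close> is the
  \<open>eps_plus\<close> term, \<open>h d x\<close> the \<open>eps_minus\<close> term and
  \<open>d h x\<close> the \<open>eps01\<close> term.\<close>

lemma contraction_data_interval:
  "contraction_data interval_complex plus_complex i_plus p_plus h_plus"
  unfolding contraction_data_def cochain_complex_def cochain_map_def graded_map_def linear_on_def
    interval_complex_def plus_complex_def subspace_def i_plus_def
  by (auto simp: span_eps d_interval_eq h_plus_eq p_plus_eq vec_cell_eq_iff eps_nth field_simps)

text \<open>On the reduced sector the \<open>eps_plus\<close> coefficient vanishes, so the same two
  terms \<open>h d x\<close> and \<open>d h x\<close> already add up to \<open>x\<close>.\<close>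

lemma contracting_homotopy_exc: "contracting_homotopy exc_complex h_plus"
  unfolding contracting_homotopy_def cochain_complex_def graded_map_def linear_on_def
    exc_complex_def subspace_def
  by (auto simp: span_eps d_interval_eq h_plus_eq vec_cell_eq_iff eps_nth field_simps)

theorem proposition13p1:
  shows "contraction_data interval_complex plus_complex i_plus p_plus h_plus \<and>
    (contraction_data interval_complex plus_complex i_plus p_plus h_plus \<longleftrightarrow>
      contracting_homotopy exc_complex h_plus) \<and>
    contractible_complex exc_complex \<and>
    (\<forall>A :: 'a::real_vector graded_data. cochain_complex A \<longrightarrow>
      contracting_homotopy (tensor_complex A exc_complex) (tensor_homotopy A exc_complex h_plus))"
  \<comment> \<open>Both sides of the equivalence are established outright, so it follows
    propositionally.\<close>
  using contraction_data_interval contracting_homotopy_exc contracting_homotopy_tensor_complex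
  unfolding contractible_complex_def by blast

end
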